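(* For all integers $k\ge1$, $n\ge0$ and $s\in\mathbb Z$, $$\sum_{j=k}^{\infty}(-1)^{j-k}\sum_{u=-j}^{j}p_2(n-T_j,s-u)\ge0.$$ For all integers $k\ge1$, $R,S$ with $1\le S<R$, and $N\ge0$, $$\sum_{j=k}^{\infty}(-1)^{j-k}\Bigl(p_{R,S}(N-RT_j+Sj)-p_{R,S}(N-RT_j-(j+1)S)\Bigr)\ge0.$$
   Context: $T_j=\binom{j+1}{2}$. For a partition $\lambda$, $|\lambda|$ denotes its size and $\ell(\lambda)$ its number of parts. $p_2(n,s)$ is the number of ordered pairs of partitions $(\alpha,\beta)$ (either may be empty) with $|\alpha|+|\beta|=n$ and $\ell(\alpha)-\ell(\beta)=s$, and $p_2(n,s)=0$ if $n<0$. For $1\le S<R$, $p_{R,S}(N)$ is the number of two-colored partitions of $N$ (parts colored $A$ or $B$) in which every $A$-colored part is congruent to $S\pmod R$ and every $B$-colored part is congruent to $-S\pmod R$, i.e. the coefficient of $q^N$ in $\prod_{i\ge0}(1-q^{S+iR})^{-1}(1-q^{R-S+iR})^{-1}$; $p_{R,S}(N)=0$ for $N<0$. The sums have only finitely many nonzero terms. *)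

theory Defs
  imports "HOL-Analysis.Infinite_Sum" "HOL-Library.Multiset" "HOL-Number_Theory.Cong"
begin

definition is_partition :: "nat multiset \<Rightarrow> bool" where
  "is_partition l \<longleftrightarrow> 0 \<notin># l"

definition T :: "nat \<Rightarrow> nat" where
  "T j = (j + 1) choose 2"

text \<open>
  The size of a partition is \<open>sum_mset\<close>, its number of parts is \<open>size\<close>.
  The argument \<open>n\<close> is an integer; the counted set is empty for \<open>n < 0\<close>.
\<close>

definition p2_pairs :: "int \<Rightarrow> int \<Rightarrow> (nat multiset \<times> nat multiset) set" where
  "p2_pairs n s = {(a, b). is_partition a \<and> is_partition b \<and>
     int (sum_mset a) + int (sum_mset b) = n \<and> int (size a) - int (size b) = s}"

definition p2 :: "int \<Rightarrow> int \<Rightarrow> nat" where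
  "p2 n s = card (p2_pairs n s)"

text \<open>
  A two-colored partition is given by its multiset \<open>a\<close> of \<open>A\<close>-colored parts and its
  multiset \<open>b\<close> of \<open>B\<close>-colored parts. The coloring matters when \<open>R = 2 * S\<close>, where both
  colors allow the same part sizes.
\<close>

definition colored_partitions :: "int \<Rightarrow> int \<Rightarrow> int \<Rightarrow> (nat multiset \<times> nat multiset) set" where
  "colored_partitions R S N = {(a, b). is_partition a \<and> is_partition b \<and>
     (\<forall>x\<in>#a. [int x = S] (mod R)) \<and> (\<forall>x\<in>#b. [int x = - S] (mod R)) \<and>
     int (sum_mset a) + int (sum_mset b) = N}"

definition pRS :: "int \<Rightarrow> int \<Rightarrow> int \<Rightarrow> nat" where
  "pRS R S N = card (colored_partitions R S N)"

text \<open>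
  \<open>card\<close> is only meaningful on finite sets, and an infinite sum of integers only when
  almost all terms vanish. Both hold here.
\<close>

lemma size_le_sum_mset: "is_partition a \<Longrightarrow> size a \<le> sum_mset a"
  by (induction a) (auto simp: is_partition_def)

lemma finite_partitions_le: "finite {a. is_partition a \<and> sum_mset a \<le> m}"
proof (rule finite_subset)
  show "{a. is_partition a \<and> sum_mset a \<le> m} \<subseteq> mset ` {xs. set xs \<subseteq> {..m} \<and> length xs \<le> m}"
  proof
    fix a assume "a \<in> {a. is_partition a \<and> sum_mset a \<le> m}"
    then have a: "is_partition a" "sum_mset a \<le> m" by auto
    obtain xs where xs: "a = mset xs" by (metis ex_mset)
    have "length xs \<le> m" using size_le_sum_mset[OF a(1)] a(2) xs by simp
    moreover have "x \<le> m" if "x \<in> set xs" for x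
      using member_le_sum_list[OF that] a(2) xs by (simp add: sum_mset_sum_list)
    ultimately show "a \<in> mset ` {xs. set xs \<subseteq> {..m} \<and> length xs \<le> m}" using xs by auto
  qed
  show "finite (mset ` {xs. set xs \<subseteq> {..m} \<and> length xs \<le> m})"
    by (intro finite_imageI finite_lists_length_le) simp
qed

lemma finite_p2_pairs: "finite (p2_pairs n s)"
  by (rule finite_subset[OF _ finite_cartesian_product[OF
        finite_partitions_le[of "nat n"] finite_partitions_le[of "nat n"]]])
     (auto simp: p2_pairs_def simp del: of_nat_sum_mset)

lemma finite_colored_partitions: "finite (colored_partitions R S N)"
  by (rule finite_subset[OF _ finite_cartesian_product[OF
        finite_partitions_le[of "nat N"] finite_partitions_le[of "nat N"]]])
     (auto simp: colored_partitions_def simp del: of_nat_sum_mset)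

lemma p2_negative: "n < 0 \<Longrightarrow> p2 n s = 0"
  by (auto simp: p2_def p2_pairs_def card_eq_0_iff simp del: of_nat_sum_mset)

lemma pRS_negative: "N < 0 \<Longrightarrow> pRS R S N = 0"
  by (auto simp: pRS_def colored_partitions_def card_eq_0_iff simp del: of_nat_sum_mset)

lemma two_T: "2 * int (T j) = int j * (int j + 1)"
proof -
  have "2 * T j = j * (j + 1)" by (simp add: T_def choose_two)
  then show ?thesis by (metis of_nat_1 of_nat_add of_nat_mult of_nat_numeral)
qed

lemma finite_support_p2:
  "finite {j. (-1) ^ (j - k) * (\<Sum>u = - int j..int j. int (p2 (n - int (T j)) (s - u))) \<noteq> 0}"
proof (rule finite_subset)
  show "{j. (-1) ^ (j - k) * (\<Sum>u = - int j..int j. int (p2 (n - int (T j)) (s - u))) \<noteq> 0}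
        \<subseteq> {..nat n}"
  proof (rule subsetI, rule ccontr)
    fix j
    assume j: "j \<in> {j. (-1) ^ (j - k) * (\<Sum>u = - int j..int j. int (p2 (n - int (T j)) (s - u))) \<noteq> 0}"
       and "j \<notin> {..nat n}"
    then have "n < int j" "1 \<le> int j" by auto
    moreover have "int j * 1 \<le> int j * int j" by (rule mult_left_mono) (use \<open>1 \<le> int j\<close> in auto)
    moreover have "2 * int (T j) = int j * int j + int j" using two_T[of j] by (simp add: algebra_simps)
    ultimately have "n - int (T j) < 0" by linarith
    then show False using j by (simp add: p2_negative)
  qed
qed simp

lemma finite_support_pRS:
  assumes "1 \<le> S" "S < R"
  shows "finite {j. (-1) ^ (j - k) * (int (pRS R S (N - R * int (T j) + S * int j))
                    - int (pRS R S (N - R * int (T j) - (int j + 1) * S))) \<noteq> 0}"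
proof (rule finite_subset)
  show "{j. (-1) ^ (j - k) * (int (pRS R S (N - R * int (T j) + S * int j))
          - int (pRS R S (N - R * int (T j) - (int j + 1) * S))) \<noteq> 0} \<subseteq> {..2 * nat N + 2}"
  proof (rule subsetI, rule ccontr)
    fix j
    assume j: "j \<in> {j. (-1) ^ (j - k) * (int (pRS R S (N - R * int (T j) + S * int j))
          - int (pRS R S (N - R * int (T j) - (int j + 1) * S))) \<noteq> 0}"
       and "j \<notin> {..2 * nat N + 2}"
    then have jN: "2 * N + 2 < int j" "2 < int j" by auto
    have "S * int j \<le> R * int j" using assms by (intro mult_right_mono) auto
    moreover have "1 * (int j * (int j - 1)) \<le> R * (int j * (int j - 1))"
      using assms jN by (intro mult_right_mono) auto
    moreover have "int j * 1 \<le> int j * (int j - 1)" using jN by (intro mult_left_mono) auto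
    moreover have "2 * (R * int (T j)) = R * (int j * (int j + 1))" using two_T[of j] by simp
    moreover have "R * (int j * (int j + 1)) = R * (int j * (int j - 1)) + 2 * (R * int j)"
      by (simp add: algebra_simps)
    ultimately have "N - R * int (T j) + S * int j < 0" using jN by linarith
    moreover have "0 \<le> S * int j" "0 \<le> (int j + 1) * S" using assms by auto
    ultimately show False using j by (simp add: pRS_negative)
  qed
qed simp

end

theory Submission
  imports Defs "HOL-Computational_Algebra.Formal_Power_Series"
begin

text \<open>
  Let \<open>P s\<close> be the generating function of \<open>p2 n s\<close> in \<open>n\<close>, let \<open>(q)_x\<close> be the product of \<open>1 - q ^ j\<close> for
  \<open>1 \<le> j \<le> x\<close>, with \<open>1 / (q)_x = 0\<close> for \<open>x < 0\<close>, and let \<open>W k\<close> be the sum of \<open>P (s - u)\<close> over \<open>\<bar>u\<bar> \<le> k\<close>.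
  The tails \<open>F k = \<Sum>j\<ge>k. (-1) ^ (j - k) * q ^ T j * W j\<close> satisfy \<open>F k + F (k + 1) = q ^ T k * W k\<close>, and
  since they tend to \<open>0\<close> this recurrence determines them. Hence \<open>F k = q ^ T k * f k\<close> for every
  sequence of power series with \<open>f k + q ^ (k + 1) * f (k + 1) = W k\<close>, and the first claim
  follows once such a sequence with visibly nonnegative coefficients is known for each \<open>s\<close>.

  The series \<open>Q m = \<Sum>y. q ^ y / ((q)_y (q)_(y + m))\<close> counts the pairs \<open>(a, b)\<close> with
  \<open>\<ell>(a) - \<ell>(b) \<le> m\<close>. So \<open>W k = Q (s + k) - Q (s - k - 1)\<close>; moreover \<open>Q m + Q (- m - 1)\<close> does not depend
  on \<open>m\<close>, because \<open>P\<close> is even, and \<open>Q (- m) = q ^ m * Q m\<close>. These relations show that for \<open>s > 0\<close>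
  one may take \<open>f k = (Q (k - s) - q ^ s * Q (k + s)) / (1 - q ^ s)\<close>. After a shift of the summation
  index in the second series the numerator is the sum over \<open>y\<close> of \<open>q ^ y\<close> times
  \<open>1 / ((q)_y (q)_(y + k - s)) - 1 / ((q)_(y - s) (q)_(y + k))\<close>, which is nonnegative because moving
  the two indices apart, with fixed sum, decreases \<open>1 / ((q)_m (q)_n)\<close> coefficientwise.
  For \<open>s < 0\<close> the symmetry \<open>P (- m) = P m\<close> applies.

  For \<open>s = 0\<close> the quotient degenerates to a logarithmic derivative. The limit suggests the sum
  over \<open>y\<close> of \<open>q ^ y / ((q)_y (q)_(y + k))\<close> times \<open>\<Sum>j=y+1..y+k. q ^ j / (1 - q ^ j)\<close>. By a
  telescoping argument this satisfies the recurrence except for a defect \<open>- 1 / (q)_k\<close>, which is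
  repaired by adding the tail \<open>\<Sum>i. (-1) ^ i * q ^ (T i + k * i) / (q)_(k + i)\<close> of one of Euler's
  expansions of the infinite product of the \<open>1 - q ^ j\<close>. The tail has negative terms, but for \<open>k \<ge> 1\<close>
  its term with index \<open>i \<ge> 1\<close> is bounded by the term \<open>y = i - 1\<close> of the nonnegative sum. For \<open>k = 0\<close>
  only the tail remains, and it equals the infinite product itself; this is why \<open>k \<ge> 1\<close> is assumed.

  The second claim is a positive combination of instances of the first. Subtracting \<open>p_{R,S}(M - S)\<close> from
  \<open>p_{R,S}(M)\<close> discards the partitions with an \<open>A\<close>-colored part \<open>S\<close>; the parts of the others are
  \<open>R * x + S\<close> and \<open>R * x - S\<close> with \<open>x \<ge> 1\<close>, so the difference counts the pairs of partitions \<open>(a, b)\<close> with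
  \<open>R * (\<bar>a\<bar> + \<bar>b\<bar>) + S * (\<ell>(a) - \<ell>(b)) = M\<close>. Summing \<open>2 * j + 1\<close> such differences gives the \<open>j\<close>-th
  term of the second sum as the sum of the \<open>j\<close>-th terms of the first over all \<open>(n, s)\<close> with
  \<open>R * n + S * s = N\<close>.
\<close>

unbundle fps_syntax

abbreviation q :: "int fps" where "q \<equiv> fps_X"

section \<open>Power series with nonnegative coefficients and infinite sums of power series\<close>

definition nonneg :: "int fps \<Rightarrow> bool" where
  "nonneg f \<longleftrightarrow> (\<forall>n. 0 \<le> f $ n)"

lemma nonneg_simps [simp, intro]: "nonneg 0" "nonneg 1" "nonneg (q ^ n)"
  by (auto simp: nonneg_def fps_X_power_iff)

lemma nonneg_add [intro]: "nonneg f \<Longrightarrow> nonneg g \<Longrightarrow> nonneg (f + g)"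
  by (simp add: nonneg_def)

lemma nonneg_mult [intro]: "nonneg f \<Longrightarrow> nonneg g \<Longrightarrow> nonneg (f * g)"
  by (simp add: nonneg_def fps_mult_nth sum_nonneg)

lemma nonneg_sum [intro]: "(\<And>i. i \<in> I \<Longrightarrow> nonneg (f i)) \<Longrightarrow> nonneg (sum f I)"
  by (simp add: nonneg_def fps_sum_nth sum_nonneg)

lemma nonneg_prod [intro]: "(\<And>i. i \<in> I \<Longrightarrow> nonneg (f i)) \<Longrightarrow> nonneg (prod f I)"
  by (induction I rule: infinite_finite_induct) auto

definition series_sum :: "(nat \<Rightarrow> int fps) \<Rightarrow> int fps" where
  "series_sum u = Abs_fps (\<lambda>n. \<Sum>y\<le>n. u y $ n)"

text \<open>
  The order of the \<open>y\<close>-th term is at least \<open>y\<close>, so that truncating the sum at \<open>n\<close>, as in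
  \<open>series_sum\<close>, does not change the coefficient of \<open>q ^ n\<close>. Only for such sequences is
  \<open>series_sum u\<close> the formal sum of the \<open>u y\<close>.
\<close>

definition convergent_terms :: "(nat \<Rightarrow> int fps) \<Rightarrow> bool" where
  "convergent_terms u \<longleftrightarrow> (\<forall>y. q ^ y dvd u y)"

lemma fps_nth_eq_0_if_dvd:
  assumes "q ^ y dvd f" "n < y" shows "f $ n = 0"
  using assms by (auto elim!: dvdE simp: fps_X_power_mult_nth)

lemma series_sum_nth:
  assumes "convergent_terms u" "n \<le> N"
  shows "series_sum u $ n = (\<Sum>y\<le>N. u y $ n)"
proof -
  have "(\<Sum>y\<le>n. u y $ n) = (\<Sum>y\<le>N. u y $ n)"
    by (rule sum.mono_neutral_left)
       (use assms in \<open>auto simp: convergent_terms_def intro: fps_nth_eq_0_if_dvd\<close>)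
  then show ?thesis by (simp add: series_sum_def)
qed

lemma series_sum_add: "series_sum (\<lambda>y. u y + v y) = series_sum u + series_sum v"
  by (simp add: series_sum_def fps_eq_iff sum.distrib)

lemma series_sum_diff: "series_sum (\<lambda>y. u y - v y) = series_sum u - series_sum v"
  by (simp add: series_sum_def fps_eq_iff sum_subtractf)

lemma nonneg_series_sum: "(\<And>y. nonneg (u y)) \<Longrightarrow> nonneg (series_sum u)"
  by (simp add: nonneg_def series_sum_def sum_nonneg)

lemma series_sum_mult:
  assumes "convergent_terms u"
  shows "series_sum (\<lambda>y. c * u y) = c * series_sum u"
proof (rule fps_ext)
  fix n
  have "series_sum (\<lambda>y. c * u y) $ n = (\<Sum>y\<le>n. \<Sum>i=0..n. c $ i * u y $ (n - i))"
    by (simp add: series_sum_def fps_mult_nth)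
  also have "\<dots> = (\<Sum>i=0..n. \<Sum>y\<le>n. c $ i * u y $ (n - i))"
    by (rule sum.swap)
  also have "\<dots> = (c * series_sum u) $ n"
    by (simp add: fps_mult_nth series_sum_nth[OF assms, of _ n] sum_distrib_left)
  finally show "series_sum (\<lambda>y. c * u y) $ n = (c * series_sum u) $ n" .
qed

lemma series_sum_shift:
  assumes "convergent_terms u" "\<And>y. y < m \<Longrightarrow> u y = 0"
  shows "series_sum u = series_sum (\<lambda>y. u (y + m))"
proof (rule fps_ext)
  fix n
  have "series_sum u $ n = (\<Sum>y\<le>n + m. u y $ n)"
    by (rule series_sum_nth) (use assms in auto)
  also have "\<dots> = (\<Sum>y\<in>{m..n + m}. u y $ n)"
    by (rule sum.mono_neutral_right) (use assms in \<open>auto simp: not_le\<close>)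
  also have "\<dots> = (\<Sum>y\<le>n. u (y + m) $ n)"
    by (rule sum.reindex_bij_witness[of _ "\<lambda>y. y + m" "\<lambda>y. y - m"]) auto
  finally show "series_sum u $ n = series_sum (\<lambda>y. u (y + m)) $ n" by (simp add: series_sum_def)
qed

lemma series_sum_split_first:
  assumes "convergent_terms u"
  shows "series_sum u = u 0 + series_sum (\<lambda>y. u (Suc y))"
proof (rule fps_ext)
  fix n
  have "series_sum u $ n = (\<Sum>y\<le>Suc n. u y $ n)"
    by (rule series_sum_nth) (use assms in auto)
  also have "\<dots> = u 0 $ n + (\<Sum>y\<le>n. u (Suc y) $ n)" by (rule sum.atMost_Suc_shift)
  finally show "series_sum u $ n = (u 0 + series_sum (\<lambda>y. u (Suc y))) $ n" by (simp add: series_sum_def)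
qed

section \<open>Partitions with a bounded number of parts\<close>

text \<open>
  The series \<open>1 / (1 - q ^ m)\<close> for \<open>m > 0\<close>.
\<close>

definition geometric :: "nat \<Rightarrow> int fps" where
  "geometric m = Abs_fps (\<lambda>n. if m dvd n then 1 else 0)"

lemma nonneg_geometric [simp, intro]: "nonneg (geometric m)"
  by (simp add: nonneg_def geometric_def)

lemma geometric_inverse: "0 < m \<Longrightarrow> (1 - q ^ m) * geometric m = 1"
  by (rule fps_ext)
     (auto simp: algebra_simps fps_X_power_mult_nth geometric_def dvd_minus_self not_less dest: dvd_imp_le)

text \<open>
  \<open>1 / (q)_x\<close>, the generating function of the partitions with at most \<open>x\<close> parts. The index is an
  integer so that the value \<open>0\<close> for \<open>x < 0\<close> makes index shifts hold without side conditions.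
\<close>

definition atmost_gf :: "int \<Rightarrow> int fps" where
  "atmost_gf x = (if x < 0 then 0 else \<Prod>j=1..nat x. geometric j)"

lemma atmost_gf_neg [simp]: "x < 0 \<Longrightarrow> atmost_gf x = 0"
  and atmost_gf_0 [simp]: "atmost_gf 0 = 1"
  by (auto simp: atmost_gf_def)

lemma atmost_gf_Suc: "atmost_gf (1 + int n) = atmost_gf (int n) * geometric (Suc n)"
proof -
  have "nat (1 + int n) = Suc n" by simp
  then show ?thesis by (simp add: atmost_gf_def)
qed

lemma nonneg_atmost_gf [simp, intro]: "nonneg (atmost_gf x)"
  by (auto simp: atmost_gf_def)

definition exactly_gf :: "int \<Rightarrow> int fps" where
  "exactly_gf x = (if x < 0 then 0 else q ^ nat x * atmost_gf x)"

lemma exactly_gf_int: "exactly_gf (int n) = q ^ n * atmost_gf (int n)"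
  by (simp add: exactly_gf_def)

lemma exactly_gf_Suc: "exactly_gf (1 + int n) = q ^ Suc n * atmost_gf (1 + int n)"
  using exactly_gf_int[of "Suc n"] by simp

lemma atmost_gf_diff_Suc:
  "atmost_gf (1 + int n) - atmost_gf (int n) = exactly_gf (1 + int n)"
proof -
  have "exactly_gf (1 + int n) = atmost_gf (int n) * geometric (Suc n) - atmost_gf (int n) * ((1 - q ^ Suc n) * geometric (Suc n))"
    by (simp add: exactly_gf_Suc atmost_gf_Suc algebra_simps del: power_Suc)
  then show ?thesis by (simp add: geometric_inverse atmost_gf_Suc del: power_Suc)
qed

lemma atmost_gf_diff: "atmost_gf x - atmost_gf (x - 1) = exactly_gf x"
proof -
  consider "x < 0" | "x = 0" | n where "x = 1 + int n"
    by (metis add.commute int_ops(4) linorder_neqE_linordered_idom not0_implies_Suc of_nat_0 zero_le_imp_eq_int nle_le less_le_not_le)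
  then show ?thesis
    by cases (use atmost_gf_diff_Suc in \<open>auto simp: exactly_gf_def\<close>)
qed

definition exactly_parts :: "nat \<Rightarrow> nat \<Rightarrow> nat multiset set" where
  "exactly_parts n r = {a. is_partition a \<and> sum_mset a = n \<and> size a = r}"

lemma finite_exactly_parts [simp]: "finite (exactly_parts n r)"
  by (rule finite_subset[OF _ finite_partitions_le[of n]]) (auto simp: exactly_parts_def)

lemma card_exactly_parts_with_one:
  "card {a \<in> exactly_parts n (Suc r). 1 \<in># a} = (if n = 0 then 0 else card (exactly_parts (n - 1) r))"
proof (cases "n = 0")
  case False
  have "bij_betw (add_mset 1) (exactly_parts (n - 1) r) {a \<in> exactly_parts n (Suc r). 1 \<in># a}"
  proof (rule bij_betw_byWitness[where f' = "\<lambda>a. a - {#1#}"])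
    show "add_mset 1 ` exactly_parts (n - 1) r \<subseteq> {a \<in> exactly_parts n (Suc r). 1 \<in># a}"
      using False by (auto simp: exactly_parts_def is_partition_def)
    show "(\<lambda>a. a - {#1#}) ` {a \<in> exactly_parts n (Suc r). 1 \<in># a} \<subseteq> exactly_parts (n - 1) r"
    proof clarify
      fix a assume a: "a \<in> exactly_parts n (Suc r)" "1 \<in># a"
      then obtain c where "a = add_mset 1 c" by (meson multi_member_split)
      with a show "a - {#1#} \<in> exactly_parts (n - 1) r"
        by (auto simp: exactly_parts_def is_partition_def)
    qed
  qed auto
  with False show ?thesis by (simp add: bij_betw_same_card)
next
  case True
  then have none: "{a \<in> exactly_parts n (Suc r). 1 \<in># a} = {}"
    by (auto simp: exactly_parts_def)
  show ?thesis unfolding none using True by simp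
qed

lemma sum_mset_Suc: "sum_mset (image_mset Suc a) = sum_mset a + size a"
  by (induction a) auto

lemma card_exactly_parts_without_one:
  "card {a \<in> exactly_parts n r. 1 \<notin># a} = (if n < r then 0 else card (exactly_parts (n - r) r))"
proof (cases "n < r")
  case False
  have shift: "image_mset (\<lambda>x. Suc (x - Suc 0)) a = a" if "0 \<notin># a" for a :: "nat multiset"
    using that by (induction a) auto
  have "bij_betw (image_mset Suc) (exactly_parts (n - r) r) {a \<in> exactly_parts n r. 1 \<notin># a}"
  proof (rule bij_betw_byWitness[where f' = "image_mset (\<lambda>x. x - 1)"])
    show "image_mset Suc ` exactly_parts (n - r) r \<subseteq> {a \<in> exactly_parts n r. 1 \<notin># a}"
      using False by (auto simp: exactly_parts_def is_partition_def sum_mset_Suc)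
    show "\<forall>a\<in>{a \<in> exactly_parts n r. 1 \<notin># a}. image_mset Suc (image_mset (\<lambda>x. x - 1) a) = a"
      by (simp add: exactly_parts_def is_partition_def multiset.map_comp comp_def shift del: Suc_pred)
    show "image_mset (\<lambda>x. x - 1) ` {a \<in> exactly_parts n r. 1 \<notin># a} \<subseteq> exactly_parts (n - r) r"
    proof clarify
      fix a assume a: "a \<in> exactly_parts n r" "1 \<notin># a"
      let ?b = "image_mset (\<lambda>x. x - 1) a"
      have "image_mset Suc ?b = a"
        using a by (simp add: exactly_parts_def is_partition_def multiset.map_comp comp_def shift del: Suc_pred)
      then have "sum_mset a = sum_mset ?b + size a" using sum_mset_Suc[of ?b] by simp
      moreover have "is_partition ?b"
        unfolding is_partition_def
      proof
        assume "0 \<in># ?b"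
        then obtain x where x: "x \<in># a" "x - 1 = 0" by auto
        then have "x = 0 \<or> x = 1" by auto
        with x a show False by (auto simp: exactly_parts_def is_partition_def)
      qed
      ultimately show "?b \<in> exactly_parts (n - r) r"
        using a by (auto simp: exactly_parts_def)
    qed
  qed (auto simp: multiset.map_comp comp_def)
  with False show ?thesis by (simp add: bij_betw_same_card)
next
  case True
  then have "exactly_parts n r = {}"
    using size_le_sum_mset by (auto simp: exactly_parts_def) (metis not_le)
  with True show ?thesis by simp
qed

text \<open>
  Removing a part \<open>1\<close>, or, if there is none, lowering all parts by one, gives the same recurrence
  for the numbers of partitions with \<open>r\<close> parts as \<open>(1 - q ^ r) / (q)_r = 1 / (q)_(r - 1)\<close> gives for
  the coefficients of \<open>q ^ r / (q)_r\<close>.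
\<close>

lemma exactly_gf_nth: "exactly_gf (int r) $ n = int (card (exactly_parts n r))"
proof -
  define c where "c r = Abs_fps (\<lambda>n. int (card (exactly_parts n r)))" for r
  have rec: "c (Suc r) = q * c r + q ^ Suc r * c (Suc r)" for r
  proof (rule fps_ext)
    fix n
    have "card (exactly_parts n (Suc r))
        = card ({a \<in> exactly_parts n (Suc r). 1 \<in># a} \<union> {a \<in> exactly_parts n (Suc r). 1 \<notin># a})"
      by (rule arg_cong[of _ _ card]) auto
    also have "\<dots> = card {a \<in> exactly_parts n (Suc r). 1 \<in># a} + card {a \<in> exactly_parts n (Suc r). 1 \<notin># a}"
      by (rule card_Un_disjoint) auto
    finally show "c (Suc r) $ n = (q * c r + q ^ Suc r * c (Suc r)) $ n"
      unfolding card_exactly_parts_with_one card_exactly_parts_without_one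
      by (auto simp: c_def fps_X_power_mult_nth simp del: power_Suc)
  qed
  have "c r = exactly_gf (int r)"
  proof (induction r)
    case 0
    have "exactly_parts n 0 = (if n = 0 then {{#}} else {})" for n
      by (auto simp: exactly_parts_def is_partition_def)
    then show ?case by (auto simp: c_def exactly_gf_def fps_eq_iff)
  next
    case (Suc r)
    have "c (Suc r) - q ^ Suc r * c (Suc r) = q * c r"
      using rec[of r] by (metis add_diff_cancel_right')
    then have "(1 - q ^ Suc r) * c (Suc r) = q * exactly_gf (int r)"
      by (simp only: Suc left_diff_distrib mult_1)
    then have "((1 - q ^ Suc r) * geometric (Suc r)) * c (Suc r) = geometric (Suc r) * (q * exactly_gf (int r))"
      by (simp add: mult_ac del: power_Suc)
    then show ?case
      by (simp add: geometric_inverse exactly_gf_int exactly_gf_Suc atmost_gf_Suc del: power_Suc)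
         (simp add: mult_ac)
  qed
  then have "exactly_gf (int r) $ n = c r $ n" by simp
  then show ?thesis by (simp add: c_def)
qed

section \<open>Pairs of partitions with a prescribed difference of lengths\<close>

definition P :: "int \<Rightarrow> int fps" where
  "P m = Abs_fps (\<lambda>n. int (p2 (int n) m))"

lemma P_uminus: "P (- m) = P m"
proof -
  have "bij_betw prod.swap (p2_pairs n (- m)) (p2_pairs n m)" for n
    by (rule bij_betw_byWitness[where f' = prod.swap]) (auto simp: p2_pairs_def)
  then have "card (p2_pairs n (- m)) = card (p2_pairs n m)" for n
    by (rule bij_betw_same_card)
  then show ?thesis by (simp add: P_def p2_def)
qed

lemma P_conv_series_sum: "P m = series_sum (\<lambda>y. exactly_gf (int y) * exactly_gf (int y + m))"
proof (rule fps_ext)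
  fix n
  define B where "B y i = (if int y + m < 0 then {} else
      exactly_parts (n - i) (nat (int y + m)) \<times> exactly_parts i y)" for y i
  have card_B: "int (card (B y i)) = exactly_gf (int y) $ i * exactly_gf (int y + m) $ (n - i)" for y i
  proof (cases "int y + m < 0")
    case False
    then show ?thesis
      using exactly_gf_nth[of "nat (int y + m)" "n - i"]
      by (simp add: B_def exactly_gf_nth card_cartesian_product)
  qed (simp add: B_def exactly_gf_def)
  have "p2_pairs (int n) m = (\<Union>(y, i)\<in>{..n} \<times> {0..n}. B y i)"
  proof (intro equalityI subsetI)
    fix z assume "z \<in> p2_pairs (int n) m"
    then obtain a b where z: "z = (a, b)" "is_partition a" "is_partition b"
      "int (sum_mset a + sum_mset b) = int n" "int (size a) = int (size b) + m"
      by (auto simp: p2_pairs_def simp del: of_nat_sum_mset)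
    then have n: "sum_mset a + sum_mset b = n" by (simp only: of_nat_eq_iff)
    have "z \<in> B (size b) (sum_mset b)"
      using z(1-3) n by (auto simp: B_def exactly_parts_def simp flip: z(5))
    moreover have "size b \<le> n" using size_le_sum_mset[OF z(3)] n by simp
    ultimately show "z \<in> (\<Union>(y, i)\<in>{..n} \<times> {0..n}. B y i)"
      using n by (intro UN_I[of "(size b, sum_mset b)"]) auto
  qed (auto simp: B_def p2_pairs_def exactly_parts_def simp del: of_nat_sum_mset split: if_splits)
  moreover have "card (\<Union>(y, i)\<in>{..n} \<times> {0..n}. B y i)
      = (\<Sum>(y, i)\<in>{..n} \<times> {0..n}. card (B y i))"
  proof (subst card_UN_disjoint)
    show "\<forall>z\<in>{..n} \<times> {0..n}. finite (case z of (y, i) \<Rightarrow> B y i)"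
      by (auto simp: B_def)
  qed (auto simp: B_def exactly_parts_def case_prod_beta)
  ultimately have "int (p2 (int n) m) = (\<Sum>y\<le>n. \<Sum>i=0..n. int (card (B y i)))"
    by (simp add: p2_def sum.cartesian_product case_prod_unfold)
  then show "P m $ n = series_sum (\<lambda>y. exactly_gf (int y) * exactly_gf (int y + m)) $ n"
    by (simp add: P_def series_sum_def fps_mult_nth card_B)
qed

text \<open>
  Pairs \<open>(a, b)\<close> in which \<open>b\<close> has exactly \<open>y\<close> parts and \<open>a\<close> at most \<open>y + m\<close>, summed over \<open>y\<close>.
\<close>

definition Q :: "int \<Rightarrow> int fps" where
  "Q m = series_sum (\<lambda>y. q ^ y * (atmost_gf (int y) * atmost_gf (int y + m)))"

lemma convergent_terms_power [simp]: "convergent_terms (\<lambda>y. q ^ y * f y)"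
  by (simp add: convergent_terms_def)

lemma Q_diff: "Q m - Q (m - 1) = P m"
proof -
  have "exactly_gf (int y + m) = atmost_gf (int y + m) - atmost_gf (int y + (m - 1))" for y
    using atmost_gf_diff[of "int y + m"] by (simp add: algebra_simps)
  then have "P m = series_sum (\<lambda>y. q ^ y * (atmost_gf (int y) * atmost_gf (int y + m))
                      - q ^ y * (atmost_gf (int y) * atmost_gf (int y + (m - 1))))"
    by (simp only: P_conv_series_sum exactly_gf_int right_diff_distrib mult.assoc)
  then show ?thesis unfolding series_sum_diff Q_def by simp
qed

text \<open>
  The two series count the pairs with length difference at most \<open>m\<close> and, after the swap of \<open>a\<close> and
  \<open>b\<close>, at least \<open>m + 1\<close>. Together these are all pairs, whatever \<open>m\<close> is.
\<close>

lemma Q_reflect: "Q m + Q (- m - 1) = Q 0 + Q (- 1)"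
proof -
  have step: "Q m + Q (- m - 1) = Q (m - 1) + Q (- (m - 1) - 1)" for m
    using Q_diff[of m] Q_diff[of "- m"] P_uminus[of m] by (simp add: algebra_simps)
  show ?thesis
  proof (induction m rule: int_induct[where k = 0])
    case (step1 i)
    then show ?case using step[of "i + 1"] by simp
  next
    case (step2 i)
    then show ?case using step[of i] by simp
  qed simp
qed

text \<open>
  The terms with \<open>y < m\<close> of the series for \<open>Q (- m)\<close> vanish; substituting \<open>y + m\<close> for \<open>y\<close> exchanges
  the two factors of the others. Bijectively, the first column of the Ferrers diagram of \<open>b\<close>, shortened
  by \<open>m\<close>, moves to \<open>a\<close>, and the two partitions trade places.
\<close>

lemma Q_minus_int: "Q (- int m) = q ^ m * Q (int m)"
proof -
  have "Q (- int m) = series_sum (\<lambda>y. q ^ (y + m) * (atmost_gf (int (y + m)) * atmost_gf (int (y + m) + - int m)))"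
    unfolding Q_def by (rule series_sum_shift) auto
  also have "\<dots> = series_sum (\<lambda>y. q ^ m * (q ^ y * (atmost_gf (int y) * atmost_gf (int y + int m))))"
    by (simp add: power_add mult_ac)
  finally show ?thesis by (simp add: series_sum_mult Q_def)
qed

text \<open>
  The form of \<open>Q m = q ^ (- m) * Q (- m)\<close> for both signs of \<open>m\<close> that stays within power series.
\<close>

lemma Q_uminus:
  assumes "int c - int d = m"
  shows "q ^ c * Q m = q ^ d * Q (- m)"
proof (cases "m \<ge> 0")
  case True
  then obtain e where "m = int e" by (metis nonneg_int_cases)
  with assms have "c = d + e" by simp
  then show ?thesis using Q_minus_int[of e] \<open>m = int e\<close> by (simp add: power_add mult_ac)
next
  case False
  define e where "e = nat (- m)"
  have e: "m = - int e" using False by (simp add: e_def)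
  with assms have "d = c + e" by simp
  then show ?thesis using Q_minus_int[of e] e by (simp add: power_add mult_ac)
qed

definition window :: "nat \<Rightarrow> int \<Rightarrow> int fps" where
  "window k s = (\<Sum>u = - int k..int k. P (s - u))"

lemma window_conv_Q: "window k s = Q (s + int k) - Q (s - int k - 1)"
proof (induction k)
  case (Suc k)
  have "{- int (Suc k)..int (Suc k)} = insert (- int (Suc k)) (insert (int (Suc k)) {- int k..int k})"
    by auto
  then have "window (Suc k) s = P (s + int (Suc k)) + (P (s - int (Suc k)) + window k s)"
    by (simp add: window_def algebra_simps)
  then show ?case
    using Suc Q_diff[of "s + int (Suc k)"] Q_diff[of "s - int (Suc k)"] by (simp add: algebra_simps)
qed (use Q_diff[of s] in \<open>simp add: window_def\<close>)

lemma window_uminus: "window k (- s) = window k s"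
  unfolding window_def
proof (rule sum.reindex_bij_witness[of _ uminus uminus])
  fix u show "P (s - - u) = P (- s - u)" using P_uminus[of "s + u"] by simp
qed auto

section \<open>Tails of the alternating sum\<close>

lemma T_Suc: "T (Suc j) = T j + Suc j"
  by (simp add: T_def numeral_2_eq_2)

lemma le_T: "j \<le> T j"
  by (induction j) (auto simp: T_Suc)

text \<open>
  The recurrence that forces \<open>q ^ T k * f k\<close> to be the tail of the alternating sum from \<open>j = k\<close> on.
\<close>

definition normalized_tails :: "int \<Rightarrow> (nat \<Rightarrow> int fps) \<Rightarrow> bool" where
  "normalized_tails s f \<longleftrightarrow> (\<forall>k. f k + q ^ Suc k * f (Suc k) = window k s)"

lemma alternating_sum_normalized_tails:
  assumes "normalized_tails s f"
  shows "(\<Sum>j=k..k + d. (-1) ^ (j - k) * (q ^ T j * window j s))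
           = q ^ T k * f k + (-1) ^ d * (q ^ T (Suc (k + d)) * f (Suc (k + d)))"
proof -
  have eq: "q ^ T j * window j s = q ^ T j * f j + q ^ T (Suc j) * f (Suc j)" for j
  proof -
    have "q ^ T j * f j + q ^ T (Suc j) * f (Suc j) = q ^ T j * (f j + q ^ Suc j * f (Suc j))"
      by (simp only: T_Suc power_add distrib_left mult.assoc)
    then show ?thesis using assms by (simp add: normalized_tails_def)
  qed
  define x where "x j = q ^ T j * f j" for j
  have "(\<Sum>j=k..k + d. (-1) ^ (j - k) * (x j + x (Suc j))) = x k + (-1) ^ d * x (Suc (k + d))"
    by (induction d) (simp_all add: algebra_simps)
  then show ?thesis by (simp only: eq x_def)
qed

text \<open>
  Multiplication by \<open>q ^ T j\<close> realises the shift \<open>n - T j\<close>; for \<open>n < T j\<close> both sides are \<open>0\<close> because \<open>p2\<close>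
  vanishes at negative sizes.
\<close>

lemma window_nth:
  "(q ^ T j * window j s) $ n = (\<Sum>u = - int j..int j. int (p2 (int n - int (T j)) (s - u)))"
  by (auto simp: fps_X_power_mult_nth window_def fps_sum_nth P_def p2_negative of_nat_diff)

text \<open>
  Up to \<open>j = N\<close> the sum telescopes to \<open>q ^ T k * f k\<close> and an end term of order \<open>T (N + 1) > n\<close>.
\<close>

lemma tail_sum_nonneg:
  assumes f: "normalized_tails s f" and "nonneg (f k)" and N: "n \<le> N"
  shows "0 \<le> (\<Sum>j=k..N. (-1) ^ (j - k) * (\<Sum>u = - int j..int j. int (p2 (int n - int (T j)) (s - u))))"
proof (cases "k \<le> N")
  case True
  then obtain d where d: "N = k + d" by (metis le_iff_add)
  have "(\<Sum>j=k..N. (-1) ^ (j - k) * (\<Sum>u = - int j..int j. int (p2 (int n - int (T j)) (s - u))))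
      = (\<Sum>j=k..k + d. (-1) ^ (j - k) * (q ^ T j * window j s)) $ n"
    unfolding fps_sum_nth d
  proof (intro sum.cong refl)
    fix j
    have "((-1) ^ (j - k) * (q ^ T j * window j s)) $ n = (-1) ^ (j - k) * (q ^ T j * window j s) $ n"
      by (cases "even (j - k)") auto
    then show "(-1) ^ (j - k) * (\<Sum>u = - int j..int j. int (p2 (int n - int (T j)) (s - u)))
        = ((-1) ^ (j - k) * (q ^ T j * window j s)) $ n"
      by (simp only: window_nth)
  qed
  also have "\<dots> = (q ^ T k * f k) $ n"
  proof -
    have "n < T (Suc (k + d))" using le_T[of "Suc (k + d)"] N d by simp
    then have "((-1) ^ d * (q ^ T (Suc (k + d)) * f (Suc (k + d)))) $ n = 0"
      by (intro fps_nth_eq_0_if_dvd) auto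
    then show ?thesis unfolding alternating_sum_normalized_tails[OF f] by simp
  qed
  also have "\<dots> \<ge> 0" using assms(2) by (auto simp: fps_X_power_mult_nth nonneg_def)
  finally show ?thesis .
qed simp

section \<open>Nonzero difference of lengths\<close>

text \<open>
  The factor \<open>1 - q ^ d\<close> cancels one of the factors \<open>1 / (1 - q ^ j)\<close>.
\<close>

lemma nonneg_atmost_gf_mult_one_minus:
  assumes "1 \<le> d" "int d \<le> n"
  shows "nonneg (atmost_gf n * (1 - q ^ d))"
proof -
  have "atmost_gf n = geometric d * (\<Prod>j\<in>{1..nat n} - {d}. geometric j)"
    using assms by (auto simp: atmost_gf_def intro: prod.remove)
  then have "atmost_gf n * (1 - q ^ d) = ((1 - q ^ d) * geometric d) * (\<Prod>j\<in>{1..nat n} - {d}. geometric j)"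
    by (simp add: mult_ac)
  also have "nonneg \<dots>" using assms by (auto simp: geometric_inverse)
  finally show ?thesis .
qed

text \<open>
  The common factor \<open>1 / ((q)_(m - 1) (q)_n)\<close> leaves
  \<open>1 / (1 - q ^ m) - 1 / (1 - q ^ (n + 1)) = q ^ m (1 - q ^ (n + 1 - m)) / ((1 - q ^ m) (1 - q ^ (n + 1)))\<close>,
  and \<open>1 - q ^ (n + 1 - m)\<close> cancels against a factor of \<open>(q)_(n + 1)\<close>.
\<close>

lemma atmost_gf_exchange_step:
  assumes "m \<le> n"
  shows "nonneg (atmost_gf m * atmost_gf n - atmost_gf (m - 1) * atmost_gf (n + 1))"
proof (cases "m \<le> 0")
  case False
  then obtain i where i: "m = 1 + int i" by (metis zle_iff_zadd zless_imp_add1_zle add_0 not_le)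
  \<comment> \<open>With these parameters the cancelling factor has exponent \<open>n + 1 - m = e + 1\<close>.\<close>
  obtain e where e: "n = int (i + e) + 1" using assms i by (metis zle_iff_zadd add.commute add.assoc of_nat_add)
  define g where "g = geometric (Suc i)"
  define h where "h = geometric (Suc (Suc (i + e)))"
  define r where "r = q ^ Suc i"
  define d where "d = q ^ Suc e"
  have g: "(1 - r) * g = 1" and h: "(1 - r * d) * h = 1"
    using geometric_inverse[of "Suc i"] geometric_inverse[of "Suc (Suc (i + e))"]
    by (simp_all add: g_def h_def r_def d_def power_add mult_ac)
  have gh: "g - h = r * (1 - d) * g * h"
    using g h by algebra
  have "atmost_gf m = atmost_gf (int i) * g" "atmost_gf (n + 1) = atmost_gf n * h"
    using atmost_gf_Suc[of i] atmost_gf_Suc[of "Suc (i + e)"]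
    by (simp_all add: i e g_def h_def add_ac)
  then have "atmost_gf m * atmost_gf n - atmost_gf (m - 1) * atmost_gf (n + 1)
      = atmost_gf (int i) * atmost_gf n * (g - h)"
    by (simp add: i algebra_simps)
  also have "\<dots> = atmost_gf (int i) * g * r * (atmost_gf (n + 1) * (1 - q ^ Suc e))"
    unfolding gh \<open>atmost_gf (n + 1) = atmost_gf n * h\<close> d_def by (simp add: mult_ac)
  also have "nonneg \<dots>"
    using e by (intro nonneg_mult nonneg_atmost_gf_mult_one_minus) (auto simp: r_def g_def simp del: power_Suc)
  finally show ?thesis .
qed (auto intro!: nonneg_mult)

lemma atmost_gf_exchange:
  assumes "m \<le> n"
  shows "nonneg (atmost_gf m * atmost_gf n - atmost_gf (m - int d) * atmost_gf (n + int d))"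
proof (induction d)
  case (Suc d)
  have "nonneg (atmost_gf (m - int d) * atmost_gf (n + int d)
      - atmost_gf (m - int d - 1) * atmost_gf (n + int d + 1))"
    using assms by (intro atmost_gf_exchange_step) auto
  from nonneg_add[OF Suc this] show ?case by (simp add: algebra_simps)
qed simp

text \<open>
  Shifting the second series by \<open>s\<close> turns \<open>q ^ s * q ^ y\<close> into the weight \<open>q ^ y\<close> of the first. The
  index pairs \<open>(y, y + k - s)\<close> and \<open>(y - s, y + k)\<close> then have the same sum, and the second is further
  apart: by \<open>s\<close> on each side if \<open>s \<le> k\<close>, otherwise by \<open>k\<close>.
\<close>

lemma nonneg_Q_difference: "nonneg (Q (int k - int s) - q ^ s * Q (int k + int s))"
proof -
  let ?a = atmost_gf
  have "series_sum (\<lambda>y. q ^ y * (?a (int y - int s) * ?a (int y + int k)))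
      = series_sum (\<lambda>y. q ^ (y + s) * (?a (int (y + s) - int s) * ?a (int (y + s) + int k)))"
    by (rule series_sum_shift) auto
  also have "\<dots> = series_sum (\<lambda>y. q ^ s * (q ^ y * (?a (int y) * ?a (int y + (int k + int s)))))"
    by (simp add: power_add mult_ac add_ac)
  also have "\<dots> = q ^ s * Q (int k + int s)"
    by (simp add: series_sum_mult Q_def)
  finally have "Q (int k - int s) - q ^ s * Q (int k + int s) =
      series_sum (\<lambda>y. q ^ y * (?a (int y) * ?a (int y + (int k - int s)))
               - q ^ y * (?a (int y - int s) * ?a (int y + int k)))"
    by (simp add: series_sum_diff Q_def)
  also have "\<dots> = series_sum (\<lambda>y. q ^ y * (?a (int y) * ?a (int y + int k - int s)
               - ?a (int y - int s) * ?a (int y + int k)))"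
    by (simp add: algebra_simps)
  also have "nonneg \<dots>"
  proof (intro nonneg_series_sum nonneg_mult nonneg_simps)
    fix y
    show "nonneg (?a (int y) * ?a (int y + int k - int s) - ?a (int y - int s) * ?a (int y + int k))"
    proof (cases "s \<le> k")
      case True
      then show ?thesis using atmost_gf_exchange[of "int y" "int y + int k - int s" s] by simp
    next
      case False
      then show ?thesis using atmost_gf_exchange[of "int y + int k - int s" "int y" k]
        by (simp add: mult_ac)
    qed
  qed
  finally show ?thesis .
qed

definition unequal_tail :: "nat \<Rightarrow> nat \<Rightarrow> int fps" where
  "unequal_tail s k = geometric s * (Q (int k - int s) - q ^ s * Q (int k + int s))"

lemma nonneg_unequal_tail: "nonneg (unequal_tail s k)"
  unfolding unequal_tail_def by (intro nonneg_mult nonneg_geometric nonneg_Q_difference)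

text \<open>
  Reflecting the arguments of the two values of \<open>Q\<close> in \<open>f (k + 1)\<close> expresses them by those in \<open>f k\<close>,
  and a factor \<open>1 - q ^ s\<close> splits off.
\<close>

lemma normalized_tails_unequal:
  assumes "0 < s"
  shows "normalized_tails (int s) (unequal_tail s)"
  unfolding normalized_tails_def
proof
  fix k
  define R where "R = Q 0 + Q (- 1)"
  let ?A = "Q (int k - int s)" and ?B = "Q (int k + int s)"
  have "q ^ Suc k * Q (int (Suc k) - int s) = q ^ s * Q (- (int (Suc k) - int s))"
    by (rule Q_uminus) simp
  moreover have "Q (- (int (Suc k) - int s)) = R - ?A"
    using Q_reflect[of "int k - int s"] by (simp add: R_def algebra_simps)
  moreover have "q ^ (Suc k + s) * Q (int (Suc k) + int s) = q ^ 0 * Q (- (int (Suc k) + int s))"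
    by (rule Q_uminus) simp
  moreover have "Q (- (int (Suc k) + int s)) = R - ?B"
  proof -
    have eq: "- (int (Suc k) + int s) = - (int k + int s) - 1" by simp
    show ?thesis
      using Q_reflect[of "int k + int s"] unfolding eq R_def by (metis add_diff_cancel_left')
  qed
  ultimately have
    "q ^ Suc k * (Q (int (Suc k) - int s) - q ^ s * Q (int (Suc k) + int s)) = q ^ s * (R - ?A) - (R - ?B)"
    by (simp add: right_diff_distrib power_add mult_ac)
  then have "unequal_tail s k + q ^ Suc k * unequal_tail s (Suc k)
      = geometric s * (?A - q ^ s * ?B + (q ^ s * (R - ?A) - (R - ?B)))"
    unfolding unequal_tail_def by (simp only: distrib_left mult.left_commute[of _ "geometric s"])
  also have "\<dots> = ((1 - q ^ s) * geometric s) * (?A + ?B - R)"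
    by (simp add: algebra_simps)
  also have "\<dots> = ?A + ?B - R" using assms by (simp add: geometric_inverse)
  also have "\<dots> = window k (int s)"
    using Q_reflect[of "int k - int s"] by (simp add: window_conv_Q R_def algebra_simps)
  finally show "unequal_tail s k + q ^ Suc k * unequal_tail s (Suc k) = window k (int s)" .
qed

section \<open>Equal lengths\<close>

text \<open>
  Up to the factor \<open>ln q\<close> and an additive constant, this is the logarithmic derivative of
  \<open>1 / (q)_y\<close> with respect to \<open>y\<close>.
\<close>

definition lambert :: "nat \<Rightarrow> int fps" where
  "lambert y = (\<Sum>j=1..y. q ^ j * geometric j)"

lemma lambert_Suc: "lambert (Suc y) = lambert y + q ^ Suc y * geometric (Suc y)"
  by (simp add: lambert_def)

lemma lambert_diff: "lambert (y + k) - lambert y = (\<Sum>j=y + 1..y + k. q ^ j * geometric j)"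
  by (induction k) (simp_all add: lambert_Suc del: power_Suc)

lemma power_dvd_lambert_diff: "q ^ y dvd lambert (y + k) - lambert y"
  unfolding lambert_diff by (intro dvd_sum dvd_mult2 le_imp_power_dvd) auto

text \<open>
  The \<open>y\<close>-th term of \<open>(Q (k - s) - q ^ s * Q (k + s)) / (1 - q ^ s)\<close> in the formal limit \<open>s \<rightarrow> 0\<close>.
  Its coefficients count the triples \<open>(a, b, c)\<close> in which \<open>b\<close> has \<open>y\<close> parts, \<open>a\<close> at most \<open>y + k\<close>, and
  \<open>1 \<le> c\<close> is at most the \<open>(y + 1)\<close>-st largest part of \<open>a\<close>.
\<close>

definition marked :: "nat \<Rightarrow> nat \<Rightarrow> int fps" where
  "marked k y = q ^ y * (atmost_gf (int y) * atmost_gf (int (y + k)) * (lambert (y + k) - lambert y))"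

definition euler_tail :: "nat \<Rightarrow> nat \<Rightarrow> int fps" where
  "euler_tail k i = q ^ (T i + k * i) * atmost_gf (int (k + i))"

definition equal_tail :: "nat \<Rightarrow> int fps" where
  "equal_tail k = series_sum (\<lambda>i. (-1) ^ i * euler_tail k i) + series_sum (marked k)"

lemma convergent_terms_euler_tail: "convergent_terms (\<lambda>i. (-1) ^ i * euler_tail k i)"
  unfolding convergent_terms_def euler_tail_def
proof
  fix i
  have "i \<le> T i + k * i" using le_T[of i] by simp
  then show "q ^ i dvd (-1) ^ i * (q ^ (T i + k * i) * atmost_gf (int (k + i)))"
    by (intro dvd_mult dvd_mult2 le_imp_power_dvd)
qed

lemma euler_tail_0: "euler_tail k 0 = atmost_gf (int k)"
  by (simp add: euler_tail_def T_def numeral_2_eq_2)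

text \<open>
  Since \<open>T (i + 1) + k * (i + 1) = (k + 1) + T i + (k + 1) * i\<close>, the shifted series for \<open>k + 1\<close> is the
  series for \<open>k\<close> without its first term and with opposite signs.
\<close>

lemma euler_tail_recurrence:
  "series_sum (\<lambda>i. (-1) ^ i * euler_tail k i) + q ^ Suc k * series_sum (\<lambda>i. (-1) ^ i * euler_tail (Suc k) i)
     = atmost_gf (int k)"
proof -
  have "q ^ Suc k * ((-1) ^ i * euler_tail (Suc k) i) = - ((-1) ^ Suc i * euler_tail k (Suc i))" for i
  proof -
    have "T (Suc i) + k * Suc i = Suc k + (T i + Suc k * i)" by (simp add: T_Suc)
    moreover have "k + Suc i = Suc k + i" by simp
    ultimately have "euler_tail k (Suc i) = q ^ Suc k * euler_tail (Suc k) i"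
      by (simp only: euler_tail_def power_add mult.assoc)
    then show ?thesis by (simp add: mult_ac)
  qed
  then have "q ^ Suc k * series_sum (\<lambda>i. (-1) ^ i * euler_tail (Suc k) i)
      = series_sum (\<lambda>i. 0 - (-1) ^ Suc i * euler_tail k (Suc i))"
    by (simp add: series_sum_mult[OF convergent_terms_euler_tail, symmetric] del: power_Suc)
  also have "\<dots> = series_sum (\<lambda>_. 0) - series_sum (\<lambda>i. (-1) ^ Suc i * euler_tail k (Suc i))"
    by (rule series_sum_diff)
  also have "series_sum (\<lambda>_. 0) = 0" by (simp add: series_sum_def fps_eq_iff)
  finally show ?thesis
    using series_sum_split_first[OF convergent_terms_euler_tail, of k] euler_tail_0[of k]
    by (simp del: power_Suc)
qed

lemma convergent_terms_marked: "convergent_terms (marked k)"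
  unfolding convergent_terms_def marked_def by simp

text \<open>
  When the series for \<open>Q k\<close> and \<open>- q ^ (k + 1) * Q (k + 1)\<close> are subtracted termwise from the left side,
  the \<open>y\<close>-th term becomes \<open>w y - w (y - 1)\<close> for the sequence \<open>w\<close> of the proof, except that \<open>1 / (q)_k\<close>
  takes the place of \<open>w (-1)\<close>. As \<open>w y\<close> has order greater than \<open>y\<close>, the sum of these
  differences is \<open>- 1 / (q)_k\<close>.
\<close>

lemma marked_recurrence:
  "series_sum (marked k) + q ^ Suc k * series_sum (marked (Suc k))
     = Q (int k) - q ^ Suc k * Q (int (Suc k)) - atmost_gf (int k)"
proof -
  define a where "a y = atmost_gf (int y)" for y
  define w where "w y = a y * a (y + Suc k) * (lambert (y + Suc k) - lambert y)" for y
  define t where "t y = (marked k y + q ^ Suc k * marked (Suc k) y)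
      - (q ^ y * (a y * a (y + k)) - q ^ Suc k * (q ^ y * (a y * a (y + Suc k))))" for y
  have conv_w: "convergent_terms w"
    unfolding convergent_terms_def w_def
    by (intro allI dvd_mult power_dvd_lambert_diff)
  have a_step: "a (Suc y) = a y + q ^ Suc y * a (Suc y)" for y
    using atmost_gf_diff_Suc[of y] exactly_gf_Suc[of y] by (simp add: a_def algebra_simps del: power_Suc)
  have a_lambert: "a y * lambert (Suc y) = a y * lambert y + q ^ Suc y * a (Suc y)" for y
    using atmost_gf_Suc[of y] by (simp add: a_def lambert_Suc algebra_simps del: power_Suc)
  have t_0: "t 0 = w 0 - a 0 * a k"
  proof -
    have "a 0 = 1" "lambert 0 = 0" by (simp_all add: a_def lambert_def)
    moreover define x where "x = q ^ Suc k"
    ultimately show ?thesis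
      using a_step[of k] a_lambert[of k]
      unfolding t_def w_def marked_def a_def[symmetric] add_0 power_0 x_def[symmetric] by algebra
  qed
  have t_Suc: "t (Suc y) = w (Suc y) - w y" for y
  proof -
    \<comment> \<open>Writing the powers of \<open>q\<close> as variables reduces the claim to a polynomial identity.\<close>
    define b where "b = Suc (y + k)"
    have idx: "Suc y + k = b" "Suc y + Suc k = Suc b" "y + Suc k = b"
      by (simp_all add: b_def)
    define r x z where "r = q ^ Suc k" and "x = q ^ Suc y" and "z = q ^ Suc b"
    have "z = r * x" by (simp add: r_def x_def z_def b_def power_add mult_ac)
    then show ?thesis
      using a_step[of y] a_lambert[of y] a_step[of b] a_lambert[of b]
      unfolding t_def w_def marked_def a_def[symmetric] idx
        r_def[symmetric] x_def[symmetric] z_def[symmetric]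
      by algebra
  qed
  have "series_sum t = series_sum (marked k) + q ^ Suc k * series_sum (marked (Suc k))
      - (Q (int k) - q ^ Suc k * Q (int (Suc k)))"
  proof -
    have "series_sum t = series_sum (marked k) + series_sum (\<lambda>y. q ^ Suc k * marked (Suc k) y)
      - (series_sum (\<lambda>y. q ^ y * (a y * a (y + k))) - series_sum (\<lambda>y. q ^ Suc k * (q ^ y * (a y * a (y + Suc k)))))"
      unfolding t_def series_sum_diff series_sum_add ..
    then show ?thesis
      by (simp only: series_sum_mult convergent_terms_marked convergent_terms_power Q_def a_def of_nat_add)
  qed
  moreover have "series_sum t = - a k"
  proof -
    have "convergent_terms t"
      unfolding convergent_terms_def t_def marked_def by (auto intro!: dvd_add dvd_diff dvd_mult)
    then have "series_sum t = t 0 + series_sum (\<lambda>y. w (Suc y) - w y)"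
      by (simp add: series_sum_split_first t_Suc)
    also have "\<dots> = - (a 0 * a k)"
      unfolding series_sum_diff t_0 using series_sum_split_first[OF conv_w] by simp
    finally show ?thesis by (simp add: a_def)
  qed
  ultimately show ?thesis by (simp add: a_def algebra_simps del: power_Suc)
qed

lemma normalized_tails_equal: "normalized_tails 0 equal_tail"
  unfolding normalized_tails_def
proof
  fix k
  have "0 - int k - 1 = - int (Suc k)" by simp
  then have "window k 0 = Q (int k) - q ^ Suc k * Q (int (Suc k))"
    using Q_minus_int[of "Suc k"] unfolding window_conv_Q by (simp only: add_0)
  moreover have "equal_tail k + q ^ Suc k * equal_tail (Suc k)
      = (series_sum (\<lambda>i. (-1) ^ i * euler_tail k i) + q ^ Suc k * series_sum (\<lambda>i. (-1) ^ i * euler_tail (Suc k) i))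
        + (series_sum (marked k) + q ^ Suc k * series_sum (marked (Suc k)))"
    unfolding equal_tail_def distrib_left by (simp only: add_ac)
  ultimately show "equal_tail k + q ^ Suc k * equal_tail (Suc k) = window k 0"
    unfolding euler_tail_recurrence marked_recurrence by simp
qed

lemma atmost_gf_nth_ge_1:
  "1 \<le> atmost_gf (1 + int y) $ n"
proof -
  have "atmost_gf (1 + int y) = (\<Prod>j\<in>{1..Suc y} - {1}. geometric j) * geometric 1"
  proof -
    have "nat (1 + int y) = Suc y" by simp
    moreover have "(\<Prod>j\<in>{1..Suc y}. geometric j) = geometric 1 * (\<Prod>j\<in>{1..Suc y} - {1}. geometric j)"
      by (rule prod.remove) auto
    ultimately show ?thesis by (simp add: atmost_gf_def mult.commute)
  qed
  moreover define h where "h = (\<Prod>j\<in>{1..Suc y} - {1}. geometric j)"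
  moreover have "h $ 0 = 1"
    unfolding h_def by (induction rule: finite_induct[OF finite_Diff[OF finite_atLeastAtMost]])
      (auto simp: geometric_def)
  moreover have "nonneg h" unfolding h_def by auto
  moreover have "(h * geometric 1) $ n = (\<Sum>i=0..n. h $ i)"
    by (simp add: fps_mult_nth geometric_def)
  moreover have "h $ 0 \<le> (\<Sum>i=0..n. h $ i)"
    using \<open>nonneg h\<close> by (intro member_le_sum) (auto simp: nonneg_def)
  ultimately show ?thesis by simp
qed

text \<open>
  Keep from \<open>lambert (y + k) - lambert y\<close> only the summand \<open>j = y + 1\<close>, which exists as \<open>k > 0\<close>. Then
  \<open>marked k y\<close> becomes \<open>1 / (q)_(y + k)\<close> times \<open>q ^ (2 * y + 1) / (q)_(y + 1)\<close>, a series all of whose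
  coefficients from \<open>q ^ (2 * y + 1)\<close> on are at least \<open>1\<close>. The other factor of
  \<open>euler_tail k (y + 1)\<close>, besides \<open>1 / (q)_(y + k)\<close>, is \<open>q ^ (T (y + 1) + k * (y + 1)) / (1 - q ^ (k + y + 1))\<close>,
  with coefficients at most \<open>1\<close> and an order of at least \<open>2 * y + 1\<close>.
\<close>

lemma euler_tail_le_marked:
  assumes "0 < k"
  shows "nonneg (marked k y - euler_tail k (Suc y))"
proof -
  let ?a = "atmost_gf (int (y + k))" and ?g = "q ^ Suc y * geometric (Suc y)"
  let ?E = "T (Suc y) + k * Suc y"
  obtain k' where k: "k = Suc k'" using assms gr0_implies_Suc by blast
  have "nonneg (lambert (y + k) - lambert y - ?g)"
  proof -
    have "lambert (y + k) - lambert y - ?g = lambert (Suc y + k') - lambert (Suc y)"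
      by (simp add: k lambert_Suc)
    moreover have "nonneg (lambert (Suc y + k') - lambert (Suc y))"
      unfolding lambert_diff by (intro nonneg_sum nonneg_mult nonneg_simps nonneg_geometric)
    ultimately show ?thesis by simp
  qed
  then have 1: "nonneg (q ^ y * (atmost_gf (int y) * ?a * (lambert (y + k) - lambert y - ?g)))"
    by (intro nonneg_mult) auto
  have E: "2 * y + 1 \<le> ?E"
  proof -
    have "1 * Suc y \<le> k * Suc y" using assms by (intro mult_right_mono) auto
    then have "Suc y + 1 * Suc y \<le> ?E" by (intro add_mono le_T)
    moreover have "2 * y + 1 \<le> Suc y + 1 * Suc y" by simp
    ultimately show ?thesis by (rule order.trans[rotated])
  qed
  have "nonneg (q ^ (2 * y + 1) * atmost_gf (1 + int y) - q ^ ?E * geometric (Suc (k + y)))"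
    unfolding nonneg_def
  proof
    fix n
    have "0 \<le> atmost_gf (1 + int y) $ i" "geometric (Suc (k + y)) $ j \<le> atmost_gf (1 + int y) $ i" for i j
      using atmost_gf_nth_ge_1[of y i] by (auto simp: geometric_def)
    then show "0 \<le> (q ^ (2 * y + 1) * atmost_gf (1 + int y) - q ^ ?E * geometric (Suc (k + y))) $ n"
      using E by (simp add: fps_X_power_mult_nth del: power_Suc)
  qed
  then have 2: "nonneg (?a * (q ^ (2 * y + 1) * atmost_gf (1 + int y) - q ^ ?E * geometric (Suc (k + y))))"
    by (intro nonneg_mult) auto
  have "marked k y - euler_tail k (Suc y)
      = q ^ y * (atmost_gf (int y) * ?a * (lambert (y + k) - lambert y - ?g))
        + ?a * (q ^ (2 * y + 1) * atmost_gf (1 + int y) - q ^ ?E * geometric (Suc (k + y)))"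
  proof -
    have "q ^ (2 * y + 1) = q ^ y * q ^ Suc y"
      by (simp add: mult_2 power_add)
    moreover have "atmost_gf (int (k + Suc y)) = ?a * geometric (Suc (k + y))"
      using atmost_gf_Suc[of "y + k"] by (simp add: add_ac)
    ultimately show ?thesis
      unfolding marked_def euler_tail_def atmost_gf_Suc
      by (simp only: right_diff_distrib mult_ac) simp
  qed
  then show ?thesis by (simp only: nonneg_add[OF 1 2])
qed

lemma nonneg_euler_tail: "nonneg (euler_tail k i)"
  unfolding euler_tail_def by (intro nonneg_mult) auto

lemma nonneg_equal_tail:
  assumes "0 < k"
  shows "nonneg (equal_tail k)"
proof -
  have "equal_tail k = euler_tail k 0 + series_sum (\<lambda>i. (-1) ^ Suc i * euler_tail k (Suc i) + marked k i)"
    unfolding equal_tail_def series_sum_add using series_sum_split_first[OF convergent_terms_euler_tail, of k] by simp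
  also have "nonneg \<dots>"
  proof (rule nonneg_add, rule nonneg_euler_tail, rule nonneg_series_sum)
    fix i
    have "nonneg (euler_tail k (Suc i) + euler_tail k (Suc i) + (marked k i - euler_tail k (Suc i)))"
      using assms by (intro nonneg_add nonneg_euler_tail euler_tail_le_marked)
    then show "nonneg ((-1) ^ Suc i * euler_tail k (Suc i) + marked k i)"
      using euler_tail_le_marked[OF assms, of i] by (cases "even i") (auto simp: algebra_simps)
  qed
  finally show ?thesis .
qed

lemma p2_tail_nonneg:
  assumes "0 < k" "n \<le> N"
  shows "0 \<le> (\<Sum>j=k..N. (-1) ^ (j - k) * (\<Sum>u = - int j..int j. int (p2 (int n - int (T j)) (s - u))))"
proof -
  consider "s = 0" | m where "0 < m" "s = int m" | m where "0 < m" "s = - int m"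
    by (metis int_cases4 neg_0_equal_iff_equal of_nat_0 gr0I)
  then show ?thesis
  proof cases
    case 1
    then show ?thesis using tail_sum_nonneg normalized_tails_equal nonneg_equal_tail assms by blast
  next
    case (2 m)
    then show ?thesis using tail_sum_nonneg normalized_tails_unequal nonneg_unequal_tail assms by blast
  next
    case (3 m)
    have "normalized_tails (- int m) (unequal_tail m)"
      using normalized_tails_unequal[OF 3(1)] by (simp add: normalized_tails_def window_uminus)
    then show ?thesis using 3 tail_sum_nonneg nonneg_unequal_tail assms by blast
  qed
qed

section \<open>Partitions in two residue classes\<close>

text \<open>
  The two-colored partitions of \<open>M\<close> that have no \<open>A\<close>-colored part equal to \<open>S\<close>, with each part
  \<open>R * x + S\<close> or \<open>R * x - S\<close> replaced by \<open>x\<close>.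
\<close>

definition weighted_pairs :: "int \<Rightarrow> int \<Rightarrow> int \<Rightarrow> (nat multiset \<times> nat multiset) set" where
  "weighted_pairs R S M = {(a, b). is_partition a \<and> is_partition b \<and>
     R * (int (sum_mset a) + int (sum_mset b)) + S * (int (size a) - int (size b)) = M}"

lemma sum_mset_affine:
  assumes "\<And>x. x \<in># a \<Longrightarrow> 0 \<le> R * int x + c"
  shows "int (sum_mset (image_mset (\<lambda>x. nat (R * int x + c)) a)) = R * int (sum_mset a) + c * int (size a)"
  using assms by (induction a) (auto simp: algebra_simps)

lemma image_mset_inverse:
  assumes "\<And>x. x \<in># a \<Longrightarrow> g (f x) = x"
  shows "image_mset g (image_mset f a) = a"
  using assms by (induction a) auto

text \<open>
  A positive number congruent to \<open>- S\<close> is \<open>R * x - S\<close> with \<open>x \<ge> 1\<close>, and one congruent to \<open>S\<close> is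
  \<open>R * x + S\<close> with \<open>x \<ge> 0\<close>; the missing value \<open>S\<close> is the one with \<open>x = 0\<close>. So replacing parts by their
  \<open>x\<close> maps bijectively to pairs of partitions.
\<close>

lemma card_colored_without_S:
  assumes "1 \<le> S" "S < R"
  shows "card {(a, b) \<in> colored_partitions R S M. nat S \<notin># a} = card (weighted_pairs R S M)"
proof -
  define f where "f c x = nat (R * int x + c)" for c x
  define g where "g c x = nat ((int x - c) div R)" for c x
  have pos: "0 < R * int x + c" if "x \<noteq> 0" "c = S \<or> c = - S" for x c
  proof -
    have "R * 1 \<le> R * int x" using assms that by (intro mult_left_mono) auto
    then show ?thesis using that(2) assms by (elim disjE) linarith+
  qed
  have gf: "g c (f c x) = x" if "x \<noteq> 0" "c = S \<or> c = - S" for x c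
    using pos[OF that] assms by (simp add: f_def g_def)
  have fg: "f c (g c x) = x \<and> g c x \<noteq> 0"
    if x: "x \<noteq> 0" "[int x = c] (mod R)" "c = S \<and> x \<noteq> nat S \<or> c = - S" for x c
  proof -
    obtain i where i: "int x = R * i + c"
      using x(2) by (metis cong_iff_lin cong_sym mult.commute add.commute)
    have "0 < i"
    proof (rule ccontr)
      assume "\<not> 0 < i"
      then consider "i = 0" | "i \<le> - 1" by linarith
      then show False
      proof cases
        case 1
        then show ?thesis using i x assms by auto
      next
        case 2
        then have "R * i \<le> R * (- 1)" using assms by (intro mult_left_mono) auto
        then show ?thesis using i x(3) assms by auto
      qed
    qed
    moreover have "(int x - c) div R = i" using i assms by simp
    ultimately show ?thesis using i by (simp add: f_def g_def)
  qed
  have "bij_betw (\<lambda>(a, b). (image_mset (f S) a, image_mset (f (- S)) b))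
     (weighted_pairs R S M) {(a, b) \<in> colored_partitions R S M. nat S \<notin># a}"
  proof (rule bij_betw_byWitness[where f' = "\<lambda>(a, b). (image_mset (g S) a, image_mset (g (- S)) b)"])
    have nz: "x \<noteq> 0" if "is_partition a" "x \<in># a" for x a
      using that unfolding is_partition_def by metis
    have inv: "image_mset (g c) (image_mset (f c) a) = a" if "is_partition a" "c = S \<or> c = - S" for a c
      using that by (intro image_mset_inverse gf nz)
    show "\<forall>z\<in>weighted_pairs R S M.
        (case case z of (a, b) \<Rightarrow> (image_mset (f S) a, image_mset (f (- S)) b) of
          (a, b) \<Rightarrow> (image_mset (g S) a, image_mset (g (- S)) b)) = z"
      by (auto simp: weighted_pairs_def inv simp del: multiset.map_comp)
    have sum_f: "int (sum_mset (image_mset (f c) a)) = R * int (sum_mset a) + c * int (size a)"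
      if "is_partition a" "c = S \<or> c = - S" for a c
      unfolding f_def
    proof (rule sum_mset_affine)
      fix x assume "x \<in># a"
      from pos[OF nz[OF that(1) this] that(2)] show "0 \<le> R * int x + c" by simp
    qed
    have part_f: "is_partition (image_mset (f c) a)" "\<forall>x\<in>#image_mset (f c) a. [int x = c] (mod R)"
      if "is_partition a" "c = S \<or> c = - S" for a c
    proof -
      have fx: "int (f c x) = R * int x + c" "f c x \<noteq> 0" if "x \<in># a" for x
        using pos[OF nz[OF \<open>is_partition a\<close> that] \<open>c = S \<or> c = - S\<close>] by (auto simp: f_def)
      then have "0 \<notin> f c ` set_mset a" by (metis imageE)
      then show "is_partition (image_mset (f c) a)" by (simp add: is_partition_def)
      show "\<forall>x\<in>#image_mset (f c) a. [int x = c] (mod R)"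
        using fx(1) by (auto simp: cong_def)
    qed
    have no_S: "nat S \<notin># image_mset (f S) a" if "is_partition a" for a
    proof
      assume "nat S \<in># image_mset (f S) a"
      then obtain x where x: "x \<in># a" "nat S = f S x" by auto
      then have "S = R * int x + S"
        using pos[OF nz[OF that x(1)], of S] assms unfolding f_def by linarith
      then show False using nz[OF that x(1)] assms by simp
    qed
    show "(\<lambda>(a, b). (image_mset (f S) a, image_mset (f (- S)) b)) ` weighted_pairs R S M
        \<subseteq> {(a, b) \<in> colored_partitions R S M. nat S \<notin># a}"
      using part_f no_S by (auto simp: weighted_pairs_def colored_partitions_def sum_f algebra_simps
          simp del: of_nat_sum_mset set_image_mset)
    have f_g: "image_mset (f c) (image_mset (g c) a) = a \<and> is_partition (image_mset (g c) a)"
      if a: "is_partition a" "\<forall>x\<in>#a. [int x = c] (mod R)" "c = S \<and> nat S \<notin># a \<or> c = - S" for a c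
    proof -
      have fg': "f c (g c x) = x" "g c x \<noteq> 0" if "x \<in># a" for x
        using fg[of x c] nz[OF a(1) that] a that by auto
      then have "0 \<notin> g c ` set_mset a" by (metis imageE)
      then show ?thesis by (simp add: is_partition_def image_mset_inverse fg' del: multiset.map_comp)
    qed
    show "\<forall>z\<in>{(a, b) \<in> colored_partitions R S M. nat S \<notin># a}.
        (case case z of (a, b) \<Rightarrow> (image_mset (g S) a, image_mset (g (- S)) b) of
          (a, b) \<Rightarrow> (image_mset (f S) a, image_mset (f (- S)) b)) = z"
      using f_g by (auto simp: colored_partitions_def simp del: multiset.map_comp)
    show "(\<lambda>(a, b). (image_mset (g S) a, image_mset (g (- S)) b)) `
        {(a, b) \<in> colored_partitions R S M. nat S \<notin># a} \<subseteq> weighted_pairs R S M"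
    proof clarify
      fix a b assume ab: "(a, b) \<in> colored_partitions R S M" "nat S \<notin># a"
      have a: "image_mset (f S) (image_mset (g S) a) = a" "is_partition (image_mset (g S) a)"
        and b: "image_mset (f (- S)) (image_mset (g (- S)) b) = b" "is_partition (image_mset (g (- S)) b)"
        using f_g[of a S] f_g[of b "- S"] ab by (auto simp: colored_partitions_def)
      show "(image_mset (g S) a, image_mset (g (- S)) b) \<in> weighted_pairs R S M"
        using sum_f[OF a(2), of S] sum_f[OF b(2), of "- S"] a b ab
        by (auto simp: weighted_pairs_def colored_partitions_def algebra_simps
            simp del: of_nat_sum_mset multiset.map_comp)
    qed
  qed
  then show ?thesis by (simp add: bij_betw_same_card)
qed

lemma card_colored_with_S:
  assumes "1 \<le> S"
  shows "card {(a, b) \<in> colored_partitions R S M. nat S \<in># a} = card (colored_partitions R S (M - S))"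
proof -
  have "bij_betw (\<lambda>(a, b). (add_mset (nat S) a, b)) (colored_partitions R S (M - S))
     {(a, b) \<in> colored_partitions R S M. nat S \<in># a}"
  proof (rule bij_betw_byWitness[where f' = "\<lambda>(a, b). (a - {#nat S#}, b)"])
    show "(\<lambda>(a, b). (add_mset (nat S) a, b)) ` colored_partitions R S (M - S)
        \<subseteq> {(a, b) \<in> colored_partitions R S M. nat S \<in># a}"
      using assms by (auto simp: colored_partitions_def is_partition_def simp del: of_nat_sum_mset)
    show "(\<lambda>(a, b). (a - {#nat S#}, b)) ` {(a, b) \<in> colored_partitions R S M. nat S \<in># a}
        \<subseteq> colored_partitions R S (M - S)"
    proof clarify
      fix a b assume ab: "(a, b) \<in> colored_partitions R S M" "nat S \<in># a"
      then obtain c where "a = add_mset (nat S) c" by (meson multi_member_split)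
      with ab assms show "(a - {#nat S#}, b) \<in> colored_partitions R S (M - S)"
        by (auto simp: colored_partitions_def is_partition_def simp del: of_nat_sum_mset)
    qed
  qed auto
  then show ?thesis by (simp add: bij_betw_same_card)
qed

lemma pRS_diff:
  assumes "1 \<le> S" "S < R"
  shows "int (pRS R S M) - int (pRS R S (M - S)) = int (card (weighted_pairs R S M))"
proof -
  have "card (colored_partitions R S M) = card ({(a, b) \<in> colored_partitions R S M. nat S \<in># a}
      \<union> {(a, b) \<in> colored_partitions R S M. nat S \<notin># a})"
    by (rule arg_cong[of _ _ card]) auto
  also have "\<dots> = card {(a, b) \<in> colored_partitions R S M. nat S \<in># a}
      + card {(a, b) \<in> colored_partitions R S M. nat S \<notin># a}"
    by (rule card_Un_disjoint; (rule finite_subset[OF _ finite_colored_partitions[of R S M]])?) auto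
  finally show ?thesis
    using assms by (simp add: pRS_def card_colored_with_S card_colored_without_S)
qed

lemma pRS_diff_multiple:
  assumes "1 \<le> S" "S < R"
  shows "int (pRS R S M) - int (pRS R S (M - int l * S)) = (\<Sum>i<l. int (card (weighted_pairs R S (M - int i * S))))"
proof (induction l)
  case (Suc l)
  then show ?case using pRS_diff[OF assms, of "M - int l * S"] by (simp add: algebra_simps)
qed simp

text \<open>
  The values \<open>(n, s)\<close> that index the instances of the first inequality. The bounds on \<open>n\<close> and \<open>s\<close> make the
  set finite and exclude only values for which all the counts vanish.
\<close>

definition sizes_lengths :: "int \<Rightarrow> int \<Rightarrow> int \<Rightarrow> (nat \<times> int) set" where
  "sizes_lengths R S N = {(n, s). n \<le> nat N \<and> \<bar>s\<bar> \<le> int n \<and> R * int n + S * s = N}"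

lemma finite_sizes_lengths: "finite (sizes_lengths R S N)"
  by (rule finite_subset[of _ "{..nat N} \<times> {- int (nat N)..int (nat N)}"]) (auto simp: sizes_lengths_def)

text \<open>
  A pair \<open>(a, b)\<close> belongs to \<open>n = \<bar>a\<bar> + \<bar>b\<bar> + T j\<close> and \<open>s = \<ell>(a) - \<ell>(b) + u\<close>. Since a partition has no
  more parts than its size, and \<open>\<bar>u\<bar> \<le> j \<le> T j\<close>, such \<open>(n, s)\<close> satisfy \<open>\<bar>s\<bar> \<le> n\<close>; with \<open>S < R\<close> this
  gives \<open>n \<le> N\<close>.
\<close>

lemma card_weighted_pairs:
  assumes "1 \<le> S" "S < R" "\<bar>u\<bar> \<le> int j"
  shows "card (weighted_pairs R S (N - R * int (T j) - S * u))
    = (\<Sum>(n, s)\<in>sizes_lengths R S N. p2 (int n - int (T j)) (s - u))"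
proof -
  have "weighted_pairs R S (N - R * int (T j) - S * u)
      = (\<Union>(n, s)\<in>sizes_lengths R S N. p2_pairs (int n - int (T j)) (s - u))"
  proof (intro equalityI subsetI)
    fix z assume "z \<in> weighted_pairs R S (N - R * int (T j) - S * u)"
    then obtain a b where z: "z = (a, b)" "is_partition a" "is_partition b"
      and eq: "R * (int (sum_mset a) + int (sum_mset b)) + S * (int (size a) - int (size b))
        = N - R * int (T j) - S * u"
      by (auto simp: weighted_pairs_def)
    define n where "n = sum_mset a + sum_mset b + T j"
    define s where "s = int (size a) - int (size b) + u"
    have n: "int n = int (sum_mset a) + int (sum_mset b) + int (T j)"
      by (simp only: n_def of_nat_add)
    have "\<bar>s\<bar> \<le> int n"
      using size_le_sum_mset[OF z(2)] size_le_sum_mset[OF z(3)] le_T[of j] assms(3)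
      unfolding n s_def by linarith
    moreover have N: "R * int n + S * s = N"
      using eq unfolding n s_def by (simp add: algebra_simps)
    moreover have "n \<le> nat N"
    proof -
      have "S * (- int n) \<le> S * s" using \<open>\<bar>s\<bar> \<le> int n\<close> assms by (intro mult_left_mono) auto
      moreover have "1 * int n \<le> (R - S) * int n" using assms by (intro mult_right_mono) auto
      ultimately have "int n \<le> N" using N by (simp add: algebra_simps)
      then show ?thesis by simp
    qed
    ultimately have "(n, s) \<in> sizes_lengths R S N" by (simp add: sizes_lengths_def)
    moreover have "z \<in> p2_pairs (int n - int (T j)) (s - u)"
      using z unfolding p2_pairs_def n s_def by simp
    ultimately show "z \<in> (\<Union>(n, s)\<in>sizes_lengths R S N. p2_pairs (int n - int (T j)) (s - u))"
      by auto
  next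
    fix z assume "z \<in> (\<Union>(n, s)\<in>sizes_lengths R S N. p2_pairs (int n - int (T j)) (s - u))"
    then obtain n s a b where z: "z = (a, b)" "is_partition a" "is_partition b"
      and N: "R * int n + S * s = N"
      and eq: "int (sum_mset a) + int (sum_mset b) = int n - int (T j)" "int (size a) - int (size b) = s - u"
      by (auto simp: sizes_lengths_def p2_pairs_def simp del: of_nat_sum_mset)
    have "R * (int n - int (T j)) + S * (s - u) = N - R * int (T j) - S * u"
      using N by (simp add: algebra_simps)
    then show "z \<in> weighted_pairs R S (N - R * int (T j) - S * u)"
      using z unfolding weighted_pairs_def by (simp add: eq del: of_nat_sum_mset)
  qed
  also have "card \<dots> = (\<Sum>z\<in>sizes_lengths R S N. card (case z of (n, s) \<Rightarrow> p2_pairs (int n - int (T j)) (s - u)))"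
  proof (rule card_UN_disjoint)
    show "\<forall>z\<in>sizes_lengths R S N. finite (case z of (n, s) \<Rightarrow> p2_pairs (int n - int (T j)) (s - u))"
      by (auto intro: finite_p2_pairs)
  qed (auto simp: finite_sizes_lengths p2_pairs_def simp del: of_nat_sum_mset)
  finally show ?thesis by (simp add: p2_def case_prod_unfold)
qed

text \<open>
  The two arguments of \<open>pRS\<close> differ by \<open>(2 * j + 1) * S\<close>, and the \<open>2 * j + 1\<close> steps of size \<open>S\<close>
  correspond to the values of \<open>u\<close> from \<open>- j\<close> to \<open>j\<close>.
\<close>

lemma pRS_term:
  assumes "1 \<le> S" "S < R"
  shows "int (pRS R S (N - R * int (T j) + S * int j)) - int (pRS R S (N - R * int (T j) - (int j + 1) * S))
    = (\<Sum>(n, s)\<in>sizes_lengths R S N. \<Sum>u = - int j..int j. int (p2 (int n - int (T j)) (s - u)))"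
proof -
  let ?M = "N - R * int (T j) + S * int j"
  have idx: "?M - int (2 * j + 1) * S = N - R * int (T j) - (int j + 1) * S"
    by (simp add: algebra_simps)
  have "int (pRS R S ?M) - int (pRS R S (N - R * int (T j) - (int j + 1) * S))
      = (\<Sum>i<2 * j + 1. int (card (weighted_pairs R S (?M - int i * S))))"
    using pRS_diff_multiple[OF assms, of ?M "2 * j + 1"] unfolding idx .
  also have "\<dots> = (\<Sum>u = - int j..int j. int (card (weighted_pairs R S (N - R * int (T j) - S * u))))"
    by (rule sum.reindex_bij_witness[of _ "\<lambda>u. nat (u + int j)" "\<lambda>i. int i - int j"])
       (auto simp: algebra_simps)
  also have "\<dots> = (\<Sum>u = - int j..int j. \<Sum>(n, s)\<in>sizes_lengths R S N. int (p2 (int n - int (T j)) (s - u)))"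
    by (intro sum.cong refl) (simp add: card_weighted_pairs[OF assms] abs_le_iff case_prod_unfold)
  also have "\<dots> = (\<Sum>(n, s)\<in>sizes_lengths R S N. \<Sum>u = - int j..int j. int (p2 (int n - int (T j)) (s - u)))"
    unfolding case_prod_unfold by (rule sum.swap)
  finally show ?thesis .
qed

lemma infsum_tail_conv_sum:
  fixes f :: "nat \<Rightarrow> int"
  assumes "\<And>j. K < j \<Longrightarrow> f j = 0"
  shows "(\<Sum>\<^sub>\<infinity>j\<in>{k..}. f j) = (\<Sum>j=k..K. f j)"
proof -
  have "(\<Sum>\<^sub>\<infinity>j\<in>{k..}. f j) = (\<Sum>\<^sub>\<infinity>j\<in>{k..K}. f j)"
    by (rule infsum_cong_neutral) (use assms in auto)
  then show ?thesis by simp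
qed

lemma p2_sum_eq_0: "n < j \<Longrightarrow> (\<Sum>u = - int j..int j. int (p2 (int n - int (T j)) (s - u))) = 0"
  using le_T[of j] by (simp add: p2_negative)

theorem corollary4p4:
  shows "(\<forall>(k::nat) (n::int) (s::int). 1 \<le> k \<longrightarrow> 0 \<le> n \<longrightarrow>
            0 \<le> (\<Sum>\<^sub>\<infinity>j\<in>{k..}. (-1) ^ (j - k) *
                  (\<Sum>u = - int j..int j. int (p2 (n - int (T j)) (s - u)))))
       \<and> (\<forall>(k::nat) (R::int) (S::int) (N::int). 1 \<le> k \<longrightarrow> 1 \<le> S \<longrightarrow> S < R \<longrightarrow> 0 \<le> N \<longrightarrow>
            0 \<le> (\<Sum>\<^sub>\<infinity>j\<in>{k..}. (-1) ^ (j - k) *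
                  (int (pRS R S (N - R * int (T j) + S * int j))
                   - int (pRS R S (N - R * int (T j) - (int j + 1) * S)))))"
proof (intro conjI allI impI)
  fix k :: nat and n s :: int
  assume "1 \<le> k" "0 \<le> n"
  then obtain m where m: "n = int m" by (metis nonneg_int_cases)
  have "(\<Sum>\<^sub>\<infinity>j\<in>{k..}. (-1) ^ (j - k) * (\<Sum>u = - int j..int j. int (p2 (n - int (T j)) (s - u))))
      = (\<Sum>j=k..m. (-1) ^ (j - k) * (\<Sum>u = - int j..int j. int (p2 (int m - int (T j)) (s - u))))"
    unfolding m by (rule infsum_tail_conv_sum) (simp only: p2_sum_eq_0 mult_zero_right)
  then show "0 \<le> (\<Sum>\<^sub>\<infinity>j\<in>{k..}. (-1) ^ (j - k) * (\<Sum>u = - int j..int j. int (p2 (n - int (T j)) (s - u))))"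
    using p2_tail_nonneg[of k m m s] \<open>1 \<le> k\<close> by simp
next
  fix k :: nat and R S N :: int
  assume "1 \<le> k" and SR: "1 \<le> S" "S < R" and "0 \<le> N"
  let ?I = "sizes_lengths R S N"
  let ?w = "\<lambda>j n s. \<Sum>u = - int j..int j. int (p2 (int n - int (T j)) (s - u))"
  have "(\<Sum>\<^sub>\<infinity>j\<in>{k..}. (-1) ^ (j - k) * (int (pRS R S (N - R * int (T j) + S * int j))
          - int (pRS R S (N - R * int (T j) - (int j + 1) * S))))
      = (\<Sum>j=k..nat N. (-1) ^ (j - k) * (\<Sum>(n, s)\<in>?I. ?w j n s))"
    unfolding pRS_term[OF SR]
  proof (rule infsum_tail_conv_sum)
    fix j assume "nat N < j"
    then have "(\<Sum>(n, s)\<in>?I. ?w j n s) = 0"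
      by (intro sum.neutral) (auto simp: sizes_lengths_def p2_sum_eq_0 simp del: of_nat_sum)
    then show "(-1) ^ (j - k) * (\<Sum>(n, s)\<in>?I. ?w j n s) = 0" by simp
  qed
  also have "\<dots> = (\<Sum>(n, s)\<in>?I. \<Sum>j=k..nat N. (-1) ^ (j - k) * ?w j n s)"
    unfolding case_prod_unfold sum_distrib_left by (subst sum.swap) (rule refl)
  also have "\<dots> \<ge> 0"
    using p2_tail_nonneg \<open>1 \<le> k\<close> by (intro sum_nonneg) (auto simp: sizes_lengths_def)
  finally show "0 \<le> (\<Sum>\<^sub>\<infinity>j\<in>{k..}. (-1) ^ (j - k) * (int (pRS R S (N - R * int (T j) + S * int j))
          - int (pRS R S (N - R * int (T j) - (int j + 1) * S))))" .
qed

end
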